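(* Let $D$ be a convex domain in $\mathbb{C}^2$ containing no complex lines. Assume that $\partial D$ is $\mathcal{C}^{1,1}$-smooth and contains an analytic disc. Then $D$ is not Gromov $k$-hyperbolic.
   Context: Let $\mathbb{D}$ be the open unit disc in $\mathbb{C}$. That $\partial D$ contains an analytic disc means that there is a non-constant holomorphic map $\mathbb{D}\to\mathbb{C}^2$ with image in $\partial D$. A complex line is a complex affine line. For a domain $D\subset\mathbb{C}^n$, the Lempert function is $l_D(z,w)=\inf\{\tanh^{-1}|\alpha| : \exists\,\varphi:\mathbb{D}\to D \text{ holomorphic with } \varphi(0)=z,\ \varphi(\alpha)=w\}$, and the Kobayashi distance $k_D$ is the largest pseudodistance on $D$ not exceeding $l_D$. For a metric space $(X,d)$ and $x,y,z\in X$, the Gromov product is $(x,y)_z=d(x,z)+d(z,y)-d(x,y)$. Put $S_d(p,q,x,w)=\min\{(p,x)_w,(x,q)_w\}-(p,q)_w$. The space $(X,d)$ is Gromov hyperbolic if $\sup_{p,q,x,w\in X}S_d(p,q,x,w)<\infty$. A domain $D$ is Gromov $k$-hyperbolic if $(D,k_D)$ is Gromov hyperbolic. *)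

theory Defs
  imports "HOL-Analysis.Analysis"
begin

definition analytic_disc :: "(complex \<Rightarrow> complex ^ 'n) \<Rightarrow> (complex ^ 'n) set \<Rightarrow> bool" where
  "analytic_disc \<phi> S \<longleftrightarrow>
     (\<forall>i. (\<lambda>\<zeta>. \<phi> \<zeta> $ i) holomorphic_on ball 0 1) \<and> \<phi> ` ball 0 1 \<subseteq> S"

definition contains_analytic_disc :: "(complex ^ 'n) set \<Rightarrow> bool" where
  "contains_analytic_disc S \<longleftrightarrow> (\<exists>\<phi>. analytic_disc \<phi> S \<and> \<not> \<phi> constant_on ball 0 1)"

definition complex_line :: "(complex ^ 'n) set \<Rightarrow> bool" where
  "complex_line L \<longleftrightarrow> (\<exists>a b. b \<noteq> 0 \<and> L = range (\<lambda>t. a + t *s b))"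

text \<open>The boundary is given near each of its points by a local defining function whose gradient
  exists, does not vanish and is Lipschitz. The condition is local, so that the Lipschitz constant
  may depend on the point when the boundary is not compact. Since \<open>G\<close> does not vanish on \<open>U\<close>,
  the zero set of \<open>\<rho>\<close> in \<open>U\<close> is exactly the part of the boundary in \<open>U\<close>.\<close>

definition C11_boundary :: "'a::euclidean_space set \<Rightarrow> bool" where
  "C11_boundary D \<longleftrightarrow>
     (\<forall>p \<in> frontier D. \<exists>U \<rho> G L.
        open U \<and> p \<in> U \<and>
        (\<forall>x\<in>U. (\<rho> has_derivative (\<lambda>v. G x \<bullet> v)) (at x) \<and> G x \<noteq> 0) \<and>
        L-lipschitz_on U G \<and>
        D \<inter> U = {x\<in>U. \<rho> x < (0::real)})"

definition lempert :: "(complex ^ 'n) set \<Rightarrow> complex ^ 'n \<Rightarrow> complex ^ 'n \<Rightarrow> real" where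
  "lempert D z w =
     Inf {artanh (cmod \<alpha>) | \<alpha> \<phi>.
            \<alpha> \<in> ball 0 1 \<and> analytic_disc \<phi> D \<and> \<phi> 0 = z \<and> \<phi> \<alpha> = w}"

definition pseudodistance_on :: "'a set \<Rightarrow> ('a \<Rightarrow> 'a \<Rightarrow> real) \<Rightarrow> bool" where
  "pseudodistance_on X d \<longleftrightarrow>
     (\<forall>x\<in>X. d x x = 0) \<and>
     (\<forall>x\<in>X. \<forall>y\<in>X. 0 \<le> d x y \<and> d x y = d y x) \<and>
     (\<forall>x\<in>X. \<forall>y\<in>X. \<forall>z\<in>X. d x z \<le> d x y + d y z)"

text \<open>A pointwise supremum of pseudodistances is again a pseudodistance, so that this is the largest
  one below the Lempert function, see the lemma \<open>kobayashi_greatest\<close>.\<close>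

definition kobayashi :: "(complex ^ 'n) set \<Rightarrow> complex ^ 'n \<Rightarrow> complex ^ 'n \<Rightarrow> real" where
  "kobayashi D z w =
     Sup {d z w | d. pseudodistance_on D d \<and> (\<forall>x\<in>D. \<forall>y\<in>D. d x y \<le> lempert D x y)}"

text \<open>There is no factor \<open>1/2\<close> in this convention.\<close>

definition gromov_product :: "('a \<Rightarrow> 'a \<Rightarrow> real) \<Rightarrow> 'a \<Rightarrow> 'a \<Rightarrow> 'a \<Rightarrow> real" where
  "gromov_product d x y z = d x z + d z y - d x y"

definition gromov_S :: "('a \<Rightarrow> 'a \<Rightarrow> real) \<Rightarrow> 'a \<Rightarrow> 'a \<Rightarrow> 'a \<Rightarrow> 'a \<Rightarrow> real" where
  "gromov_S d p q x w =
     min (gromov_product d p x w) (gromov_product d x q w) - gromov_product d p q w"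

definition gromov_hyperbolic :: "'a set \<Rightarrow> ('a \<Rightarrow> 'a \<Rightarrow> real) \<Rightarrow> bool" where
  "gromov_hyperbolic X d \<longleftrightarrow>
     bdd_above {gromov_S d p q x w | p q x w. p \<in> X \<and> q \<in> X \<and> x \<in> X \<and> w \<in> X}"

text \<open>The hypothesis below, which says that any two points lie on a common disc, makes the infimum
  in the Lempert function range over a nonempty set; it holds in every domain.\<close>

lemma kobayashi_greatest:
  fixes D :: "(complex ^ 'n) set"
  assumes joined: "\<And>z w. z \<in> D \<Longrightarrow> w \<in> D \<Longrightarrow>
    \<exists>\<alpha> \<phi>. \<alpha> \<in> ball 0 1 \<and> analytic_disc \<phi> D \<and> \<phi> 0 = z \<and> \<phi> \<alpha> = w"
  shows "pseudodistance_on D (kobayashi D)"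
    and "\<And>z w. z \<in> D \<Longrightarrow> w \<in> D \<Longrightarrow> kobayashi D z w \<le> lempert D z w"
    and "\<And>d z w. pseudodistance_on D d \<Longrightarrow> (\<forall>x\<in>D. \<forall>y\<in>D. d x y \<le> lempert D x y) \<Longrightarrow>
           z \<in> D \<Longrightarrow> w \<in> D \<Longrightarrow> d z w \<le> kobayashi D z w"
proof -
  define F where
    "F = {d. pseudodistance_on D d \<and> (\<forall>x\<in>D. \<forall>y\<in>D. d x y \<le> lempert D x y)}"
  have k: "kobayashi D z w = (SUP d\<in>F. d z w)" for z w
    unfolding kobayashi_def F_def by (rule arg_cong[where f = Sup]) auto
  have artanh_nonneg: "0 \<le> artanh t" if "0 \<le> t" "t < 1" for t :: real
    using that by (simp add: artanh_def)
  have nonneg: "0 \<le> lempert D z w" if "z \<in> D" "w \<in> D" for z w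
    unfolding lempert_def
    by (rule cInf_greatest) (use joined[OF that] artanh_nonneg in auto)
  then have zero: "(\<lambda>_ _. 0) \<in> F"
    by (auto simp: F_def pseudodistance_on_def)
  have upper: "d z w \<le> kobayashi D z w" if "d \<in> F" "z \<in> D" "w \<in> D" for d z w
    unfolding k
    by (rule cSUP_upper[OF that(1)], rule bdd_aboveI[where M = "lempert D z w"])
       (use that in \<open>auto simp: F_def\<close>)
  have least: "kobayashi D z w \<le> c" if "\<And>d. d \<in> F \<Longrightarrow> d z w \<le> c" for z w c
    unfolding k using zero that by (intro cSUP_least) auto
  have "kobayashi D x x = 0" if "x \<in> D" for x
  proof (rule antisym)
    show "kobayashi D x x \<le> 0"
      by (rule least) (use that in \<open>auto simp: F_def pseudodistance_on_def\<close>)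
  qed (use upper[OF zero that that] in simp)
  moreover have "0 \<le> kobayashi D x y" if "x \<in> D" "y \<in> D" for x y
    using upper[OF zero that] by simp
  moreover have "kobayashi D x y = kobayashi D y x" if "x \<in> D" "y \<in> D" for x y
    unfolding k by (rule SUP_cong) (use that in \<open>auto simp: F_def pseudodistance_on_def\<close>)
  moreover have "kobayashi D x z \<le> kobayashi D x y + kobayashi D y z"
    if "x \<in> D" "y \<in> D" "z \<in> D" for x y z
  proof (rule least)
    fix d assume d: "d \<in> F"
    then have "d x z \<le> d x y + d y z"
      using that by (simp add: F_def pseudodistance_on_def)
    then show "d x z \<le> kobayashi D x y + kobayashi D y z"
      using upper[OF d that(1,2)] upper[OF d that(2,3)] by linarith
  qed
  ultimately show "pseudodistance_on D (kobayashi D)"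
    by (simp add: pseudodistance_on_def)
  show "kobayashi D z w \<le> lempert D z w" if "z \<in> D" "w \<in> D" for z w
    by (rule least) (use that in \<open>auto simp: F_def\<close>)
  show "d z w \<le> kobayashi D z w" if "pseudodistance_on D d"
    "\<forall>x\<in>D. \<forall>y\<in>D. d x y \<le> lempert D x y" "z \<in> D" "w \<in> D" for d z w
    using upper[of d] that by (simp add: F_def)
qed

end

theory Submission
  imports Defs "HOL-Complex_Analysis.Riemann_Mapping"
begin

text \<open>
  The boundary of \<open>D\<close> contains a piece that the Kobayashi distance sees as a product, and a product
  of two unbounded directions is never Gromov hyperbolic, like the plane with the maximum norm.

  By the open mapping theorem an analytic disc in the boundary of a convex domain lies in a complex
  line inside a supporting real hyperplane (\<open>analytic_disc_frontier_affine\<close>). The closure of \<open>D\<close>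
  meets this line in a closed convex set \<open>F\<close> with nonempty interior, which is not the whole line
  because \<open>D\<close> contains no complex line. Choose a frontier point \<open>b\<close> of \<open>F\<close> that is touched by a disc
  in \<open>F\<close>. Since the unit normal of the boundary is locally Lipschitz, balls of a uniform radius
  touch the boundary from inside near \<open>b\<close>; hence \<open>D\<close> contains the product of a disc that touches
  the boundary in the normal direction and a disc in \<open>F\<close> that touches the frontier of \<open>F\<close> at \<open>b\<close>
  (\<open>C11_boundary_flat_bidisc\<close>).

  Let \<open>P \<tau> \<upsilon>\<close> be the point of this bidisc at hyperbolic arc lengths \<open>\<tau>\<close> and \<open>\<upsilon>\<close> along the radii
  towards the boundary in the two factors. As the bidisc lies in \<open>D\<close>, the distance of two such
  points is at most the maximum of the two coordinate differences (\<open>kobayashi_le_bidisc\<close>). Lower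
  bounds come from half-spaces that contain \<open>D\<close>, which are preimages of half-planes under
  holomorphic functions (\<open>kobayashi_ge_half_space\<close>). The supporting half-space at the flat piece
  shows that \<open>\<tau>\<close> is measured correctly up to a constant. A half-space that cuts off a point of the
  line just outside \<open>F\<close>, beyond \<open>b\<close>, shows that \<open>P \<tau> 0\<close> and \<open>P \<tau> U\<close> are at distance at
  least \<open>U\<close> minus a constant, as soon as \<open>\<tau>\<close> is large in terms of \<open>U\<close>
  (\<open>kobayashi_tangential_lower_bound\<close>).

  The square with vertices \<open>P (T - r) r\<close>, \<open>P T 0\<close>, \<open>P (T + r) r\<close>, \<open>P T (2 * r)\<close> then has sides of
  length at most \<open>r\<close> and, for large \<open>T\<close>, diagonals of length at least \<open>2 * r\<close> minus a constant.
  Letting \<open>r\<close> grow contradicts the four-point condition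
  (\<open>long_quadrilaterals_not_gromov_hyperbolic\<close>).
\<close>

section \<open>The hyperbolic tangent\<close>

lemma abs_tanh_less_one: "\<bar>tanh x\<bar> < 1" for x :: real
  using tanh_real_lt_1[of x] tanh_real_gt_neg1[of x] by linarith

lemma artanh_cmod_nonneg: "cmod \<alpha> < 1 \<Longrightarrow> 0 \<le> artanh (cmod \<alpha>)"
  by (simp add: artanh_def)

text \<open>For \<open>0 \<le> \<tau>\<close> the distance of \<open>tanh \<tau>\<close> from the unit circle is \<open>exp (- 2 * \<tau>)\<close> up to
  a factor between \<open>1\<close> and \<open>2\<close>. The next three lemmas use this to convert ratios
  of Euclidean distances into differences of logarithmic coordinates.\<close>

lemma ln_one_minus_tanh:
  fixes \<tau> :: real
  shows "ln (1 - tanh \<tau>) = ln 2 - ln (exp (2 * \<tau>) + 1)"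
proof -
  define E where "E = exp (2 * \<tau>)"
  have E: "0 < E"
    by (simp add: E_def)
  have "tanh \<tau> = (1 - inverse E) / (1 + inverse E)"
    by (simp add: tanh_real_altdef E_def exp_minus)
  also have "\<dots> = (E - 1) / (E + 1)"
    using E by (simp add: divide_simps)
  finally have "1 - tanh \<tau> = 2 / (E + 1)"
    using E by (simp add: field_simps)
  then show ?thesis
    using E by (simp add: ln_div flip: E_def)
qed

lemma ln_one_minus_tanh_le:
  fixes \<tau> :: real
  shows "ln (1 - tanh \<tau>) \<le> ln 2 - 2 * \<tau>"
proof -
  have "2 * \<tau> = ln (exp (2 * \<tau>))"
    by simp
  also have "\<dots> \<le> ln (exp (2 * \<tau>) + 1)"
    by (rule ln_mono) (simp add: add_pos_pos)+
  finally show ?thesis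
    unfolding ln_one_minus_tanh by linarith
qed

lemma ln_one_minus_tanh_ge:
  fixes \<tau> :: real
  assumes "0 \<le> \<tau>"
  shows "- 2 * \<tau> \<le> ln (1 - tanh \<tau>)"
proof -
  have "ln (exp (2 * \<tau>) + 1) \<le> ln (2 * exp (2 * \<tau>))"
    using assms by (intro ln_mono) (simp add: add_pos_pos)+
  also have "\<dots> = ln 2 + 2 * \<tau>"
    by (simp add: ln_mult)
  finally show ?thesis
    unfolding ln_one_minus_tanh by linarith
qed

section \<open>Half-planes, and lower bounds for the Kobayashi distance\<close>

text \<open>The Cayley transform that sends \<open>h 0\<close> to \<open>0\<close> turns \<open>h\<close> into a self-map of the disc that fixes
  \<open>0\<close>. The Schwarz lemma bounds this self-map at \<open>\<alpha>\<close>, and dropping the imaginary part of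
  \<open>h \<alpha> - h 0\<close> from the bound leaves the Harnack inequality for the real parts.\<close>

lemma right_half_plane_Harnack:
  fixes h :: "complex \<Rightarrow> complex"
  assumes hol: "h holomorphic_on ball 0 1"
    and pos: "\<And>\<zeta>. \<zeta> \<in> ball 0 1 \<Longrightarrow> 0 < Re (h \<zeta>)"
    and \<alpha>: "\<alpha> \<in> ball 0 1"
  shows "\<bar>ln (Re (h \<alpha>)) - ln (Re (h 0))\<bar> \<le> 2 * artanh (cmod \<alpha>)"
proof -
  define c where "c = h 0"
  have c: "0 < Re c"
    unfolding c_def by (rule pos) simp
  have less: "cmod (w - c) < cmod (w + cnj c)" if "0 < Re w" for w
  proof -
    have "(cmod (w + cnj c))\<^sup>2 - (cmod (w - c))\<^sup>2 = 4 * Re w * Re c"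
      unfolding cmod_power2 by (simp add: power2_eq_square algebra_simps)
    also have "\<dots> > 0"
      using that c by simp
    finally show ?thesis
      by (simp add: power_less_imp_less_base)
  qed
  have nz: "w + cnj c \<noteq> 0" if "0 < Re w" for w
    using less[OF that] by auto
  define g where "g = (\<lambda>\<zeta>. (h \<zeta> - c) / (h \<zeta> + cnj c))"
  have "g holomorphic_on ball 0 1"
    unfolding g_def by (intro holomorphic_intros hol nz pos)
  moreover have "g 0 = 0"
    by (simp add: g_def c_def)
  moreover have "cmod (g \<zeta>) < 1" if "cmod \<zeta> < 1" for \<zeta>
    using less[OF pos, of \<zeta>] nz[OF pos, of \<zeta>] that by (simp add: g_def norm_divide)
  ultimately have "cmod (g \<alpha>) \<le> cmod \<alpha>"
    using \<alpha> by (intro Schwarz_Lemma) auto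
  define r where "r = cmod \<alpha>"
  have r: "0 \<le> r" "r < 1"
    using \<alpha> by (auto simp: r_def)
  define X a where "X = Re (h \<alpha>)" and "a = Re c"
  have X: "0 < X" "0 < a"
    using pos[OF \<alpha>] c by (auto simp: X_def a_def)
  have "cmod (h \<alpha> - c) \<le> r * cmod (h \<alpha> + cnj c)"
    using \<open>cmod (g \<alpha>) \<le> cmod \<alpha>\<close> nz[OF pos[OF \<alpha>]]
    by (simp add: g_def norm_divide field_simps r_def)
  then have "(cmod (h \<alpha> - c))\<^sup>2 \<le> (r * cmod (h \<alpha> + cnj c))\<^sup>2"
    by (intro power_mono) auto
  then have "(X - a)\<^sup>2 + (Im (h \<alpha> - c))\<^sup>2 \<le> r\<^sup>2 * ((X + a)\<^sup>2 + (Im (h \<alpha> - c))\<^sup>2)"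
    by (simp add: cmod_power2 power_mult_distrib X_def a_def)
  moreover have "r\<^sup>2 * (Im (h \<alpha> - c))\<^sup>2 \<le> (Im (h \<alpha> - c))\<^sup>2"
    using r by (intro mult_left_le_one_le) (auto simp: power_le_one)
  ultimately have "(X - a)\<^sup>2 \<le> (r * (X + a))\<^sup>2"
    unfolding power_mult_distrib distrib_left[of "r\<^sup>2"] by linarith
  then have "\<bar>X - a\<bar> \<le> r * (X + a)"
    using r X by (simp add: abs_le_square_iff [symmetric] abs_mult)
  then have "X / a \<le> (1 + r) / (1 - r)" "a / X \<le> (1 + r) / (1 - r)"
    using X r by (auto simp: field_simps abs_le_iff)
  then have "ln (X / a) \<le> ln ((1 + r) / (1 - r))" "ln (a / X) \<le> ln ((1 + r) / (1 - r))"
    using X r by (auto intro!: ln_mono)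
  then show ?thesis
    using X by (simp add: ln_div artanh_def r_def [symmetric] X_def [symmetric]
        c_def [symmetric] a_def [symmetric])
qed

text \<open>Conjugation falls on the first argument so that \<open>hermitian a\<close> is complex linear, with the real
  inner product as its real part. Every real half-space is thereby the preimage of a half-plane
  under a holomorphic function.\<close>

definition hermitian :: "complex ^ 'n \<Rightarrow> complex ^ 'n \<Rightarrow> complex" where
  "hermitian a x = (\<Sum>i\<in>UNIV. cnj (a $ i) * x $ i)"

lemma Re_hermitian: "Re (hermitian a x) = a \<bullet> x"
  by (simp add: hermitian_def inner_vec_def inner_complex_def)

lemma holomorphic_hermitian:
  assumes "\<And>i. (\<lambda>\<zeta>. \<phi> \<zeta> $ i) holomorphic_on S"
  shows "(\<lambda>\<zeta>. hermitian a (\<phi> \<zeta>)) holomorphic_on S"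
  unfolding hermitian_def by (intro holomorphic_intros assms)

definition joined_by_discs :: "(complex ^ 'n) set \<Rightarrow> bool" where
  "joined_by_discs D \<longleftrightarrow> (\<forall>z\<in>D. \<forall>w\<in>D. \<exists>\<alpha> \<phi>.
     \<alpha> \<in> ball 0 1 \<and> analytic_disc \<phi> D \<and> \<phi> 0 = z \<and> \<phi> \<alpha> = w)"

lemma joined_by_discsD:
  assumes "joined_by_discs D" "z \<in> D" "w \<in> D"
  shows "\<exists>\<alpha> \<phi>. \<alpha> \<in> ball 0 1 \<and> analytic_disc \<phi> D \<and> \<phi> 0 = z \<and> \<phi> \<alpha> = w"
  using assms by (auto simp: joined_by_discs_def)

text \<open>Half of \<open>\<bar>ln (Re w) - ln (Re w')\<bar>\<close> is the hyperbolic distance between the real parts of two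
  points of the right half-plane, in the normalization of \<^const>\<open>lempert\<close>. Pulled back by
  \<open>\<lambda>x. hermitian a x - \<beta>\<close> it becomes a pseudodistance on \<open>D\<close> that lies below the Lempert
  function by the Harnack inequality, and the Kobayashi distance is the largest of these.\<close>

lemma kobayashi_ge_half_space:
  assumes joined: "joined_by_discs D"
    and pos: "\<And>x. x \<in> D \<Longrightarrow> \<beta> < a \<bullet> x"
    and "y \<in> D" "z \<in> D"
  shows "(ln (a \<bullet> y - \<beta>) - ln (a \<bullet> z - \<beta>)) / 2 \<le> kobayashi D y z"
proof -
  define d where "d = (\<lambda>y z. \<bar>ln (a \<bullet> y - \<beta>) - ln (a \<bullet> z - \<beta>)\<bar> / 2)"
  have "pseudodistance_on D d"
    by (auto simp: pseudodistance_on_def d_def)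
  moreover have "d y z \<le> lempert D y z" if "y \<in> D" "z \<in> D" for y z
    unfolding lempert_def
  proof (rule cInf_greatest)
    show "{artanh (cmod \<alpha>) |\<alpha> \<phi>.
        \<alpha> \<in> ball 0 1 \<and> analytic_disc \<phi> D \<and> \<phi> 0 = y \<and> \<phi> \<alpha> = z} \<noteq> {}"
      using joined_by_discsD[OF joined that] by blast
  next
    fix t
    assume "t \<in> {artanh (cmod \<alpha>) |\<alpha> \<phi>.
        \<alpha> \<in> ball 0 1 \<and> analytic_disc \<phi> D \<and> \<phi> 0 = y \<and> \<phi> \<alpha> = z}"
    then obtain \<alpha> \<phi> where t: "t = artanh (cmod \<alpha>)" and \<alpha>: "\<alpha> \<in> ball 0 1"
      and \<phi>: "analytic_disc \<phi> D" "\<phi> 0 = y" "\<phi> \<alpha> = z"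
      by auto
    have "\<bar>ln (Re (hermitian a (\<phi> \<alpha>) - of_real \<beta>)) - ln (Re (hermitian a (\<phi> 0) - of_real \<beta>))\<bar>
        \<le> 2 * artanh (cmod \<alpha>)"
      using \<phi>(1) pos \<alpha>
      by (intro right_half_plane_Harnack holomorphic_intros holomorphic_hermitian)
         (auto simp: analytic_disc_def Re_hermitian image_subset_iff)
    then show "d y z \<le> t"
      by (simp add: \<phi> t d_def Re_hermitian)
  qed
  ultimately have "d y z \<le> kobayashi D y z"
    using joined_by_discsD[OF joined] assms(3,4) by (intro kobayashi_greatest(3)) auto
  then show ?thesis
    by (simp add: d_def)
qed

section \<open>Bidiscs, and upper bounds for the Kobayashi distance\<close>

text \<open>Along the real diameter of the disc, \<open>tanh\<close> is the arc length parametrization of a geodesic,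
  so a point at distance \<open>\<bar>t - s\<bar> \<le> r\<close> from \<open>tanh s\<close> can be prescribed as the value at
  \<open>tanh r\<close>: contract by the factor \<open>\<kappa>\<close>, then translate along the diameter.\<close>

lemma disc_map_through_tanh:
  fixes s t r :: real
  assumes "0 < r" "\<bar>t - s\<bar> \<le> r"
  obtains m :: "complex \<Rightarrow> complex"
  where "m holomorphic_on ball 0 1" "m ` ball 0 1 \<subseteq> ball 0 1"
    "m 0 = of_real (tanh s)" "m (of_real (tanh r)) = of_real (tanh t)"
proof
  define \<kappa> where "\<kappa> = tanh (t - s) / tanh r"
  have "\<bar>tanh (t - s)\<bar> = tanh \<bar>t - s\<bar>"
    by (rule tanh_real_abs [symmetric])
  also have "\<dots> \<le> tanh r"
    unfolding tanh_real_le_iff by (rule assms)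
  finally have \<kappa>: "\<bar>\<kappa>\<bar> \<le> 1"
    using assms by (simp add: \<kappa>_def divide_le_eq_1)
  define M where "M = Moebius_function 0 (of_real (- tanh s))"
  define m where "m = M \<circ> (\<lambda>\<zeta>. of_real \<kappa> * \<zeta>)"
  have lt: "cmod (of_real \<kappa> * \<zeta>) < 1" if "cmod \<zeta> < 1" for \<zeta>
  proof -
    have "cmod (of_real \<kappa> * \<zeta>) \<le> 1 * cmod \<zeta>"
      unfolding norm_mult using \<kappa> by (intro mult_right_mono) auto
    then show ?thesis
      using that by simp
  qed
  show "m holomorphic_on ball 0 1"
    unfolding m_def M_def using lt abs_tanh_less_one[of s]
    by (intro holomorphic_on_compose_gen[where t = "ball 0 1"] Moebius_function_holomorphic
        holomorphic_intros) (auto simp del: norm_mult of_real_minus)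
  show "m ` ball 0 1 \<subseteq> ball 0 1"
    using lt abs_tanh_less_one[of s]
    by (auto simp: m_def M_def simp del: norm_mult of_real_minus
        intro!: Moebius_function_norm_lt_1)
  show "m 0 = of_real (tanh s)"
    by (simp add: m_def M_def Moebius_function_simple)
  have "tanh t = tanh (s + (t - s))"
    by simp
  also have "\<dots> = (tanh s + tanh (t - s)) / (1 + tanh s * tanh (t - s))"
    by (rule tanh_add) (auto simp: less_imp_neq[OF cosh_real_pos, symmetric])
  finally have tanh_t: "tanh t = (tanh s + tanh (t - s)) / (1 + tanh s * tanh (t - s))" .
  have "\<kappa> * tanh r = tanh (t - s)"
    using assms by (simp add: \<kappa>_def)
  then have "complex_of_real \<kappa> * of_real (tanh r) = of_real (tanh (t - s))"
    by (metis of_real_mult)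
  then show "m (of_real (tanh r)) = of_real (tanh t)"
    by (simp add: m_def M_def Moebius_function_simple tanh_t add.commute)
qed

text \<open>Holomorphic discs in a bidisc are pairs of discs in the factors, which can be chosen
  independently as long as they use the same parameter \<open>tanh r\<close>. In the coordinates
  \<open>\<tau>\<close> and \<open>\<upsilon>\<close> the Kobayashi distance is therefore bounded by the maximum norm.\<close>

lemma kobayashi_le_bidisc:
  fixes D :: "(complex ^ 'n) set"
  assumes joined: "joined_by_discs D"
    and bidisc: "\<And>\<xi> \<eta>. cmod \<xi> < 1 \<Longrightarrow> cmod \<eta> < 1 \<Longrightarrow> p + \<xi> *s e + \<eta> *s f \<in> D"
    and r: "0 < r" "\<bar>\<tau>' - \<tau>\<bar> \<le> r" "\<bar>\<upsilon>' - \<upsilon>\<bar> \<le> r"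
  shows "kobayashi D (p + of_real (tanh \<tau>) *s e + of_real (tanh \<upsilon>) *s f)
           (p + of_real (tanh \<tau>') *s e + of_real (tanh \<upsilon>') *s f) \<le> r"
    (is "kobayashi D ?z ?w \<le> r")
proof -
  obtain m where m: "m holomorphic_on ball 0 1" "m ` ball 0 1 \<subseteq> ball 0 1"
    "m 0 = of_real (tanh \<tau>)" "m (of_real (tanh r)) = of_real (tanh \<tau>')"
    using disc_map_through_tanh[OF r(1,2)] .
  obtain n where n: "n holomorphic_on ball 0 1" "n ` ball 0 1 \<subseteq> ball 0 1"
    "n 0 = of_real (tanh \<upsilon>)" "n (of_real (tanh r)) = of_real (tanh \<upsilon>')"
    using disc_map_through_tanh[OF r(1,3)] .
  define \<phi> where "\<phi> = (\<lambda>\<zeta>. p + m \<zeta> *s e + n \<zeta> *s f)"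
  have "analytic_disc \<phi> D"
    unfolding analytic_disc_def
  proof safe
    show "(\<lambda>\<zeta>. \<phi> \<zeta> $ i) holomorphic_on ball 0 1" for i
      unfolding \<phi>_def by (simp, intro holomorphic_intros m n)
    show "\<phi> \<zeta> \<in> D" if "\<zeta> \<in> ball 0 1" for \<zeta>
      unfolding \<phi>_def using m(2) n(2) that by (intro bidisc) (auto simp: image_subset_iff)
  qed
  then have "artanh (cmod (of_real (tanh r))) \<in> {artanh (cmod \<alpha>) |\<alpha> \<phi>.
      \<alpha> \<in> ball 0 1 \<and> analytic_disc \<phi> D \<and> \<phi> 0 = ?z \<and> \<phi> \<alpha> = ?w}"
    using m(3,4) n(3,4) abs_tanh_less_one[of r]
    by (intro CollectI exI[of _ "of_real (tanh r)"] exI[of _ \<phi>]) (simp add: \<phi>_def)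
  then have "lempert D ?z ?w \<le> artanh (cmod (of_real (tanh r)))"
    unfolding lempert_def
    by (rule cInf_lower) (auto intro!: bdd_belowI[of _ 0] artanh_cmod_nonneg)
  also have "\<dots> = r"
    using r by (simp add: artanh_tanh_real)
  finally have "lempert D ?z ?w \<le> r" .
  moreover have "kobayashi D ?z ?w \<le> lempert D ?z ?w"
    using joined_by_discsD[OF joined] bidisc abs_tanh_less_one by (intro kobayashi_greatest(2)) auto
  ultimately show ?thesis
    by linarith
qed

lemma analytic_disc_affine:
  assumes "g holomorphic_on ball 0 1" "\<And>\<zeta>. \<zeta> \<in> ball 0 1 \<Longrightarrow> z + g \<zeta> *s v \<in> D"
  shows "analytic_disc (\<lambda>\<zeta>. z + g \<zeta> *s v) D"
  unfolding analytic_disc_def using assms by (auto intro!: holomorphic_intros)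

lemma continuous_on_complex_line:
  fixes z v :: "complex ^ 'n"
  shows "continuous_on S (\<lambda>t. z + t *s v)"
  unfolding vector_scalar_mult_def by (intro continuous_intros continuous_on_vec_lambda)

lemma convex_complex_line_vimage:
  fixes z v :: "complex ^ 'n"
  assumes "convex D"
  shows "convex ((\<lambda>t. z + t *s v) -` D)"
proof (rule convexI)
  fix t t' and u u' :: real
  assume *: "t \<in> (\<lambda>t. z + t *s v) -` D" "t' \<in> (\<lambda>t. z + t *s v) -` D"
    "0 \<le> u" "0 \<le> u'" "u + u' = 1"
  have "u *\<^sub>R (z + t *s v) + u' *\<^sub>R (z + t' *s v) \<in> D"
    using * assms by (intro convexD) auto
  also have "u *\<^sub>R (z + t *s v) + u' *\<^sub>R (z + t' *s v) =
      (u + u') *\<^sub>R z + (u *\<^sub>R t + u' *\<^sub>R t') *s v"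
    by (simp add: vec_eq_iff) (simp add: scaleR_conv_of_real algebra_simps)
  finally show "u *\<^sub>R t + u' *\<^sub>R t' \<in> (\<lambda>t. z + t *s v) -` D"
    using * by simp
qed

text \<open>The trace of \<open>D\<close> on the complex line through the two points is convex and is not the whole
  line, so a Riemann map of it is a disc through both points. This supplies the hypothesis of
  \<open>kobayashi_greatest\<close>.\<close>

lemma convex_line_free_joined_by_discs:
  fixes D :: "(complex ^ 'n) set"
  assumes "open D" "convex D" and no_line: "\<not> (\<exists>L. complex_line L \<and> L \<subseteq> D)"
  shows "joined_by_discs D"
  unfolding joined_by_discs_def
proof safe
  fix z w assume zw: "z \<in> D" "w \<in> D"
  show "\<exists>\<alpha> \<phi>. \<alpha> \<in> ball 0 1 \<and> analytic_disc \<phi> D \<and> \<phi> 0 = z \<and> \<phi> \<alpha> = w"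
  proof (cases "z = w")
    case True
    have "analytic_disc (\<lambda>_. z) D"
      using zw by (auto simp: analytic_disc_def)
    then show ?thesis
      using True by (intro exI[of _ 0] exI[of _ "\<lambda>_. z"]) auto
  next
    case False
    define S where "S = (\<lambda>t. z + t *s (w - z)) -` D"
    have "open S"
      unfolding S_def by (intro open_vimage \<open>open D\<close> continuous_on_complex_line)
    moreover have "convex S"
      unfolding S_def using \<open>convex D\<close> by (rule convex_complex_line_vimage)
    moreover have S01: "0 \<in> S" "1 \<in> S"
      using zw by (auto simp: S_def)
    moreover have "S \<noteq> UNIV"
    proof
      assume "S = UNIV"
      then have "range (\<lambda>t. z + t *s (w - z)) \<subseteq> D"
        by (auto simp: S_def)
      moreover have "complex_line (range (\<lambda>t. z + t *s (w - z)))"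
        using False unfolding complex_line_def
        by (intro exI[of _ z] exI[of _ "w - z"]) auto
      ultimately show False
        using no_line by blast
    qed
    ultimately have "\<exists>f g. f holomorphic_on S \<and> g holomorphic_on ball 0 1 \<and>
        (\<forall>t\<in>S. f t \<in> ball 0 1 \<and> g (f t) = t) \<and> (\<forall>\<zeta>\<in>ball 0 1. g \<zeta> \<in> S \<and> f (g \<zeta>) = \<zeta>)"
      using Riemann_mapping_theorem[of S] convex_imp_simply_connected[of S] by blast
    then obtain f g where f: "\<And>t. t \<in> S \<Longrightarrow> f t \<in> ball 0 1 \<and> g (f t) = t"
      and g: "g holomorphic_on ball 0 1" "\<And>\<zeta>. \<zeta> \<in> ball 0 1 \<Longrightarrow> g \<zeta> \<in> S \<and> f (g \<zeta>) = \<zeta>"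
      by blast
    \<comment> \<open>The Riemann map need not send \<open>0\<close> to \<open>0\<close>; a disc automorphism corrects this.\<close>
    obtain M N where M: "M (f 0) = 0" "M ` ball 0 1 \<subseteq> ball 0 1"
      and N: "N holomorphic_on ball 0 1" "N ` ball 0 1 \<subseteq> ball 0 1"
        "\<And>\<zeta>. \<zeta> \<in> ball 0 1 \<Longrightarrow> N (M \<zeta>) = \<zeta>"
      using ball_biholomorphism_exists[of "f 0"] f[OF S01(1)] by metis
    define h where "h = g \<circ> N"
    have "h holomorphic_on ball 0 1"
      unfolding h_def by (rule holomorphic_on_compose_gen[OF N(1) g(1) N(2)])
    moreover have "z + h \<zeta> *s (w - z) \<in> D" if "\<zeta> \<in> ball 0 1" for \<zeta>
      using that g(2)[of "N \<zeta>"] N(2) by (auto simp: h_def S_def image_subset_iff)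
    ultimately have "analytic_disc (\<lambda>\<zeta>. z + h \<zeta> *s (w - z)) D"
      by (rule analytic_disc_affine)
    moreover have "h (M (f 1)) = 1" "M (f 1) \<in> ball 0 1"
      using f[OF S01(2)] N(3)[of "f 1"] M(2) by (auto simp: h_def image_subset_iff)
    moreover have "h 0 = 0"
      using f[OF S01(1)] N(3)[of "f 0"] M(1) by (auto simp: h_def)
    ultimately show ?thesis
      by (intro exI[of _ "M (f 1)"] exI[of _ "\<lambda>\<zeta>. z + h \<zeta> *s (w - z)"]) auto
  qed
qed

section \<open>Analytic discs in the boundary\<close>

text \<open>The unit normal \<open>a\<close> and \<open>perp a\<close> form a unitary basis. In dimension two the complex
  tangent space of the boundary is thus a single complex line.\<close>

definition perp :: "complex ^ 2 \<Rightarrow> complex ^ 2" where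
  "perp a = (\<chi> i. if i = 1 then - cnj (a $ 2) else cnj (a $ 1))"

lemma norm_perp: "norm (perp a) = norm a"
  by (simp add: norm_vec_def L2_set_def sum_2 perp_def add.commute)

lemma hermitian_perp: "hermitian a (perp a) = 0"
  by (simp add: hermitian_def sum_2 perp_def)

lemma hermitian_smult: "hermitian a (t *s x) = t * hermitian a x"
  by (simp add: hermitian_def sum_distrib_left algebra_simps)

lemma hermitian_self: "hermitian a a = of_real ((norm a)\<^sup>2)"
proof -
  have "(norm a)\<^sup>2 = (\<Sum>i\<in>UNIV. (cmod (a $ i))\<^sup>2)"
    by (simp add: norm_vec_def L2_set_def sum_nonneg)
  then show ?thesis
    by (simp add: hermitian_def complex_norm_square mult.commute del: of_real_power)
qed

lemma norm_smult_complex: "norm (t *s x) = cmod t * norm (x :: complex ^ 'n)"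
  by (simp add: norm_vec_def L2_set_def norm_mult power_mult_distrib sum_distrib_left [symmetric]
      real_sqrt_mult)

lemma of_real_smult: "of_real r *s x = r *\<^sub>R (x :: complex ^ 'n)"
  by (simp add: vec_eq_iff) (simp add: scaleR_conv_of_real)

lemma perp_decomposition:
  assumes "norm a = 1"
  shows "x = hermitian a x *s a + hermitian (perp a) x *s perp a"
proof -
  have "hermitian a a = 1"
    using assms by (simp add: hermitian_self)
  then have 1: "a $ 1 * cnj (a $ 1) + a $ 2 * cnj (a $ 2) = 1"
    by (simp add: hermitian_def sum_2 mult.commute)
  have "x $ 1 = x $ 1 * (a $ 1 * cnj (a $ 1) + a $ 2 * cnj (a $ 2))"
    "x $ 2 = x $ 2 * (a $ 1 * cnj (a $ 1) + a $ 2 * cnj (a $ 2))"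
    unfolding 1 by simp_all
  then show ?thesis
    by (simp add: vec_eq_iff forall_2 hermitian_def sum_2 perp_def algebra_simps)
qed

text \<open>A supporting hyperplane gives the weak inequality; since \<open>D\<close> is open, a point of \<open>D\<close> can be moved
  a little against the normal without leaving \<open>D\<close>, which makes the inequality strict.\<close>

lemma supporting_half_space:
  fixes D :: "'a::euclidean_space set"
  assumes "open D" "convex D" "D \<noteq> {}" "p \<notin> D"
  obtains a where "norm a = 1" "\<And>x. x \<in> D \<Longrightarrow> 0 < a \<bullet> (x - p)"
proof -
  have "convex ((\<lambda>x. x - p) ` D)" "0 \<notin> (\<lambda>x. x - p) ` D"
    using assms by auto
  from separating_hyperplane_set_0[OF this]
  obtain a where a: "a \<noteq> 0" "\<And>x. x \<in> D \<Longrightarrow> 0 \<le> a \<bullet> (x - p)"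
    by auto
  show ?thesis
  proof
    show "norm (sgn a) = 1"
      using a by (simp add: norm_sgn)
    fix x assume x: "x \<in> D"
    obtain e where e: "0 < e" "cball x e \<subseteq> D"
      using \<open>open D\<close> x by (meson open_contains_cball)
    have "x - e *\<^sub>R sgn a \<in> D"
      using e a by (intro subsetD[OF e(2)]) (simp add: dist_norm norm_sgn)
    then have "0 \<le> a \<bullet> (x - e *\<^sub>R sgn a - p)"
      by (rule a)
    also have "\<dots> = a \<bullet> (x - p) - e * (a \<bullet> sgn a)"
      by (simp add: inner_diff_right)
    also have "a \<bullet> sgn a = norm a"
      using a by (simp add: sgn_div_norm dot_square_norm power2_eq_square)
    finally have "e * norm a \<le> a \<bullet> (x - p)"
      by simp
    moreover have "0 < e * norm a"
      using e a by simp
    ultimately have "0 < a \<bullet> (x - p)"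
      by linarith
    then show "0 < sgn a \<bullet> (x - p)"
      using a by (simp add: sgn_div_norm)
  qed
qed

text \<open>Otherwise the image would be open, and would reach from \<open>0\<close> into the left half-plane.\<close>

lemma holomorphic_Re_nonneg_zero:
  fixes h :: "complex \<Rightarrow> complex"
  assumes hol: "h holomorphic_on ball 0 1" and "\<And>\<zeta>. \<zeta> \<in> ball 0 1 \<Longrightarrow> 0 \<le> Re (h \<zeta>)"
    and "h 0 = 0" and "\<zeta> \<in> ball 0 1"
  shows "h \<zeta> = 0"
proof -
  have "h constant_on ball 0 1"
  proof (rule ccontr)
    assume "\<not> h constant_on ball 0 1"
    then have "open (h ` ball 0 1)"
      using open_mapping_thm[OF hol] by auto
    moreover have "0 \<in> h ` ball 0 1"
      using assms(3) by (metis centre_in_ball image_eqI zero_less_one)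
    ultimately obtain e where e: "0 < e" "cball 0 e \<subseteq> h ` ball 0 1"
      by (meson open_contains_cball)
    have "of_real (- e) \<in> h ` ball 0 1"
      using e(1) by (intro subsetD[OF e(2)]) simp
    then obtain \<zeta> where "\<zeta> \<in> ball 0 1" "of_real (- e) = h \<zeta>"
      by (rule imageE)
    then show False
      using assms(2)[of \<zeta>] e(1) by (metis Re_complex_of_real neg_0_le_iff_le not_le)
  qed
  then show ?thesis
    using assms(3,4) unfolding constant_on_def by (metis centre_in_ball zero_less_one)
qed

text \<open>Take a supporting real hyperplane at the centre \<open>p\<close> of the disc, with normal \<open>a\<close>. The
  function \<open>hermitian a (\<phi> \<zeta> - p)\<close> has nonnegative real part and vanishes at \<open>0\<close>, so it
  vanishes identically, and the disc stays in the complex line through \<open>p\<close> orthogonal to \<open>a\<close>.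
  Being nonconstant, it covers an open subset of that line.\<close>

lemma analytic_disc_frontier_affine:
  fixes D :: "(complex ^ 2) set"
  assumes "open D" "convex D" "D \<noteq> {}" and disc: "contains_analytic_disc (frontier D)"
  obtains a v p where "norm a = 1" "norm v = 1" "hermitian a v = 0"
    "\<And>x. x \<in> D \<Longrightarrow> 0 < a \<bullet> (x - p)"
    "interior ((\<lambda>t. p + t *s v) -` closure D) \<noteq> {}"
proof -
  obtain \<phi> where hol: "\<And>i. (\<lambda>\<zeta>. \<phi> \<zeta> $ i) holomorphic_on ball 0 1"
    and fr: "\<And>\<zeta>. \<zeta> \<in> ball 0 1 \<Longrightarrow> \<phi> \<zeta> \<in> frontier D" and nc: "\<not> \<phi> constant_on ball 0 1"
    using disc unfolding contains_analytic_disc_def analytic_disc_def by blast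
  define p where "p = \<phi> 0"
  have "p \<notin> D"
    using fr[of 0] \<open>open D\<close> by (simp add: p_def frontier_def interior_open)
  obtain a where a: "norm a = 1" "\<And>x. x \<in> D \<Longrightarrow> 0 < a \<bullet> (x - p)"
    using supporting_half_space[OF assms(1-3) \<open>p \<notin> D\<close>] by blast
  have "closure D \<subseteq> {x. a \<bullet> x \<ge> a \<bullet> p}"
    using a(2) by (intro closure_minimal closed_halfspace_ge) (auto simp: inner_diff_right less_imp_le)
  then have nonneg: "0 \<le> a \<bullet> (x - p)" if "x \<in> closure D" for x
    using that by (auto simp: inner_diff_right)
  have flat: "hermitian a (\<phi> \<zeta> - p) = 0" if "\<zeta> \<in> ball 0 1" for \<zeta>
  proof (rule holomorphic_Re_nonneg_zero[OF _ _ _ that])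
    show "(\<lambda>\<zeta>. hermitian a (\<phi> \<zeta> - p)) holomorphic_on ball 0 1"
      by (intro holomorphic_hermitian) (simp, intro holomorphic_intros hol)
    show "0 \<le> Re (hermitian a (\<phi> \<zeta> - p))" if "\<zeta> \<in> ball 0 1" for \<zeta>
      using nonneg fr[OF that] by (simp add: Re_hermitian frontier_def)
    show "hermitian a (\<phi> 0 - p) = 0"
      by (simp add: p_def hermitian_def)
  qed
  define f where "f = (\<lambda>\<zeta>. hermitian (perp a) (\<phi> \<zeta> - p))"
  have \<phi>: "\<phi> \<zeta> = p + f \<zeta> *s perp a" if "\<zeta> \<in> ball 0 1" for \<zeta>
    using perp_decomposition[OF a(1), of "\<phi> \<zeta> - p"] flat[OF that]
    by (simp add: f_def algebra_simps)
  have "f holomorphic_on ball 0 1"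
    unfolding f_def by (intro holomorphic_hermitian) (simp, intro holomorphic_intros hol)
  moreover have "\<not> f constant_on ball 0 1"
    using nc \<phi> unfolding constant_on_def by metis
  ultimately have "open (f ` ball 0 1)"
    using open_mapping_thm[of f "ball 0 1" "ball 0 1"] by auto
  moreover have "f ` ball 0 1 \<subseteq> (\<lambda>t. p + t *s perp a) -` closure D"
    using \<phi> fr by (force simp: frontier_def)
  ultimately have "f ` ball 0 1 \<subseteq> interior ((\<lambda>t. p + t *s perp a) -` closure D)"
    by (rule interior_maximal[rotated])
  then have "interior ((\<lambda>t. p + t *s perp a) -` closure D) \<noteq> {}"
    by auto
  with a show ?thesis
    by (intro that[of a "perp a" p]) (auto simp: norm_perp hermitian_perp)
qed

text \<open>Write \<open>x + t *s v\<close> as a convex combination of a point of \<open>D\<close> slightly beyond \<open>x\<close>, as seen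
  from \<open>p\<close>, and of a point of the given line far out in the direction \<open>t *s v\<close>. The first point
  is interior, so the combination is interior as well.\<close>

lemma complex_line_in_closure:
  fixes D :: "(complex ^ 'n) set"
  assumes "open D" "convex D" "x \<in> D" "\<And>t. p + t *s v \<in> closure D"
  shows "x + t *s v \<in> D"
proof -
  obtain e where e: "0 < e" "cball x e \<subseteq> D"
    using assms(1,3) by (meson open_contains_cball)
  \<comment> \<open>The step \<open>k\<close> is small enough for \<open>x + k *\<^sub>R (x - p)\<close> to stay in the ball of radius \<open>e\<close>; the
    factor \<open>(1 + k) / k\<close> in \<open>y\<close> undoes the weight that \<open>y\<close> gets in the combination.\<close>
  define k where "k = e / (1 + norm (x - p))"
  have k: "0 < k"
    using e(1) by (simp add: k_def add_pos_nonneg)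
  have "k * norm (x - p) \<le> e * 1"
    unfolding k_def using e(1) by (simp add: divide_le_eq add_pos_nonneg)
  then have "x + k *\<^sub>R (x - p) \<in> D"
    using k by (intro subsetD[OF e(2)]) (simp add: dist_norm)
  then have inD: "x + k *\<^sub>R (x - p) \<in> interior D"
    using assms(1) by (simp add: interior_open)
  define y where "y = p + (of_real ((1 + k) / k) * t) *s v"
  have "y - (1 / (1 + k)) *\<^sub>R (y - (x + k *\<^sub>R (x - p))) \<in> interior D"
    using k assms(4) by (intro mem_interior_closure_convex_shrink[OF assms(2) inD])
      (auto simp: y_def)
  also have "y - (1 / (1 + k)) *\<^sub>R (y - (x + k *\<^sub>R (x - p))) = x + t *s v"
  proof -
    have y: "k *\<^sub>R y = k *\<^sub>R p + (1 + k) *\<^sub>R (t *s v)"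
      using k unfolding y_def
      by (simp add: vec_eq_iff) (simp add: scaleR_conv_of_real field_simps)
    have "(1 + k) *\<^sub>R (y - (1 / (1 + k)) *\<^sub>R (y - (x + k *\<^sub>R (x - p)))) =
        k *\<^sub>R y + x + k *\<^sub>R (x - p)"
    proof -
      have "(1 + k) * (1 / (1 + k)) = 1"
        using k by simp
      then show ?thesis
        unfolding scaleR_diff_right[of "1 + k" y] scaleR_scaleR by (simp add: algebra_simps)
    qed
    also have "\<dots> = (1 + k) *\<^sub>R (x + t *s v)"
      unfolding y by (simp add: algebra_simps)
    finally show ?thesis
      by (rule scaleR_left_imp_eq[rotated]) (use k in simp)
  qed
  finally show ?thesis
    using interior_subset by blast
qed

section \<open>Tangent balls\<close>

text \<open>Let \<open>b\<close> be a frontier point nearest to an interior point \<open>c0\<close>. The ball around \<open>c0\<close> through \<open>b\<close>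
  lies in \<open>F\<close>, and shrinking it towards \<open>b\<close> produces arbitrarily small balls in \<open>F\<close> that
  have \<open>b\<close> on their boundary.\<close>

lemma frontier_touched_by_small_balls:
  fixes F :: "'a::euclidean_space set"
  assumes "closed F" "interior F \<noteq> {}" "F \<noteq> UNIV"
  obtains b where "b \<in> frontier F"
    "\<And>s. 0 < s \<Longrightarrow> \<exists>c. c \<noteq> b \<and> dist b c < s \<and> ball c (dist b c) \<subseteq> F"
proof -
  obtain c0 where c0: "c0 \<in> interior F"
    using assms by auto
  have "frontier F \<noteq> {}"
    using assms c0 interior_subset frontier_eq_empty[of F] by auto
  then obtain b where b: "b \<in> frontier F" "\<And>y. y \<in> frontier F \<Longrightarrow> dist c0 b \<le> dist c0 y"
    using distance_attains_inf[OF frontier_closed] by metis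
  have "c0 \<noteq> b"
    using b(1) c0 by (auto simp: frontier_def)
  define \<rho> where "\<rho> = dist c0 b"
  have \<rho>: "0 < \<rho>"
    using \<open>c0 \<noteq> b\<close> by (simp add: \<rho>_def)
  have "ball c0 \<rho> \<subseteq> F"
  proof (rule ccontr)
    assume "\<not> ball c0 \<rho> \<subseteq> F"
    moreover have "c0 \<in> ball c0 \<rho> \<inter> F"
      using c0 \<rho> interior_subset by auto
    ultimately have "ball c0 \<rho> \<inter> frontier F \<noteq> {}"
      by (metis connected_Int_frontier connected_ball Diff_eq_empty_iff empty_iff)
    then obtain y where "y \<in> frontier F" "dist c0 y < \<rho>"
      by auto
    then show False
      using b(2)[of y] by (simp add: \<rho>_def)
  qed
  show ?thesis
  proof
    show "b \<in> frontier F" by fact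
    fix s :: real assume "0 < s"
    define \<theta> where "\<theta> = min 1 (s / (2 * \<rho>))"
    have \<theta>: "0 < \<theta>" "\<theta> \<le> 1" "\<theta> * \<rho> < s"
      using \<rho> \<open>0 < s\<close> by (auto simp: \<theta>_def min_def field_simps split: if_splits)
    define c where "c = b + \<theta> *\<^sub>R (c0 - b)"
    have bc: "dist b c = \<theta> * \<rho>"
      using \<theta> by (simp add: c_def dist_norm \<rho>_def)
    have "c0 - c = (1 - \<theta>) *\<^sub>R (c0 - b)"
      by (simp add: c_def algebra_simps)
    then have "dist c0 c = (1 - \<theta>) * \<rho>"
      using \<theta> by (simp add: dist_norm \<rho>_def)
    then have "ball c (dist b c) \<subseteq> ball c0 \<rho>"
      unfolding bc by (subst ball_subset_ball_iff) (simp add: dist_commute algebra_simps)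
    then show "\<exists>c. c \<noteq> b \<and> dist b c < s \<and> ball c (dist b c) \<subseteq> F"
      using \<open>ball c0 \<rho> \<subseteq> F\<close> bc \<theta> \<rho> by (intro exI[of _ c]) auto
  qed
qed

lemma lipschitz_gradient_estimate:
  fixes \<rho> :: "'a::euclidean_space \<Rightarrow> real"
  assumes der: "\<And>x. x \<in> U \<Longrightarrow> (\<rho> has_derivative (\<lambda>v. G x \<bullet> v)) (at x)"
    and lip: "L-lipschitz_on U G" and sub: "cball q (dist q x) \<subseteq> U"
  shows "\<rho> x \<le> \<rho> q + G q \<bullet> (x - q) + L * (norm (x - q))\<^sup>2"
proof -
  have L: "0 \<le> L"
    using lip by (rule lipschitz_on_nonneg)
  have "norm ((\<rho> x - G q \<bullet> x) - (\<rho> q - G q \<bullet> q)) \<le> (L * dist q x) * norm (x - q)"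
  proof (rule differentiable_bound[where S = "cball q (dist q x)"
        and f' = "\<lambda>y v. G y \<bullet> v - G q \<bullet> v"])
    fix y assume y: "y \<in> cball q (dist q x)"
    then have "y \<in> U" "q \<in> U"
      using sub by auto
    show "((\<lambda>x. \<rho> x - G q \<bullet> x) has_derivative (\<lambda>v. G y \<bullet> v - G q \<bullet> v))
        (at y within cball q (dist q x))"
      by (intro derivative_intros has_derivative_at_withinI[OF der] \<open>y \<in> U\<close>)
    show "onorm (\<lambda>v. G y \<bullet> v - G q \<bullet> v) \<le> L * dist q x"
    proof (rule onorm_le)
      fix v
      have "norm (G y \<bullet> v - G q \<bullet> v) \<le> norm (G y - G q) * norm v"
        unfolding inner_diff_left [symmetric] real_norm_def by (rule Cauchy_Schwarz_ineq2)
      also have "norm (G y - G q) \<le> L * dist y q"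
        using lipschitz_onD[OF lip \<open>y \<in> U\<close> \<open>q \<in> U\<close>] by (simp add: dist_norm)
      also have "L * dist y q \<le> L * dist q x"
        using y L by (intro mult_left_mono) (auto simp: dist_commute)
      finally show "norm (G y \<bullet> v - G q \<bullet> v) \<le> L * dist q x * norm v"
        by (simp add: mult_right_mono)
    qed
  qed auto
  then show ?thesis
    by (simp add: inner_diff_right dist_norm norm_minus_commute power2_eq_square algebra_simps abs_le_iff)
qed

text \<open>If the gradient of the defining function is Lipschitz, the function differs from its linear part
  at \<open>q\<close> by a quadratic error, and hence is negative on a ball of radius \<open>R\<close> tangent at \<open>q\<close>.
  The radius depends only on the Lipschitz constant and on a lower bound for the gradient, so it
  can be chosen uniformly for \<open>q\<close> near \<open>q0\<close>. A supporting half-space at \<open>q\<close> forces the gradient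
  to be a negative multiple of its normal \<open>a\<close>, so that \<open>a\<close> is the axis of the tangent ball.\<close>

lemma C11_boundary_interior_balls:
  fixes D :: "'a::euclidean_space set"
  assumes "open D" "C11_boundary D" "q0 \<in> frontier D"
  obtains R s where "0 < R" "0 < s"
    "\<And>q a x. q \<in> frontier D \<Longrightarrow> dist q q0 < s \<Longrightarrow> norm a = 1 \<Longrightarrow>
       (\<And>y. y \<in> D \<Longrightarrow> 0 < a \<bullet> (y - q)) \<Longrightarrow> (norm (x - q))\<^sup>2 < 2 * R * (a \<bullet> (x - q)) \<Longrightarrow> x \<in> D"
proof -
  obtain U \<rho> G L where U: "open U" "q0 \<in> U"
    and der: "\<And>x. x \<in> U \<Longrightarrow> (\<rho> has_derivative (\<lambda>v. G x \<bullet> v)) (at x)"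
    and G0: "\<And>x. x \<in> U \<Longrightarrow> G x \<noteq> 0"
    and lip: "L-lipschitz_on U G" and DU: "D \<inter> U = {x\<in>U. \<rho> x < (0::real)}"
    using bspec[OF assms(2)[unfolded C11_boundary_def] assms(3)] by blast
  have in_D: "y \<in> D \<longleftrightarrow> \<rho> y < 0" if "y \<in> U" for y
    using DU that by blast
  have L: "0 \<le> L"
    using lip by (rule lipschitz_on_nonneg)
  obtain e where e: "0 < e" "ball q0 e \<subseteq> U"
    using U by (meson openE)
  define g where "g = norm (G q0)"
  have g: "0 < g"
    using G0[OF U(2)] by (simp add: g_def)
  define s where "s = min (e / 2) (g / (2 * (L + 1)))"
  define R where "R = min (e / 4) (g / (8 * (L + 1)))"
  have "s \<le> e / 2" "s \<le> g / (2 * (L + 1))" "R \<le> e / 4" "R \<le> g / (8 * (L + 1))"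
    unfolding s_def R_def by (rule min.cobounded1 min.cobounded2)+
  moreover have "0 < s" "0 < R"
    using e g L by (simp_all add: s_def R_def)
  ultimately have s: "0 < s" "s \<le> e / 2" "s \<le> g / (2 * (L + 1))"
    and R: "0 < R" "R \<le> e / 4" "R \<le> g / (8 * (L + 1))"
    by blast+
  have Ls: "L * s \<le> g / 2" and LR: "2 * R * L < g / 2"
  proof -
    have "(L + 1) * s \<le> g / 2" "(L + 1) * R \<le> g / 8"
      using s(3) R(3) L by (simp_all add: field_simps)
    then show "L * s \<le> g / 2" "2 * R * L < g / 2"
      using s(1) R(1) g by (simp_all add: algebra_simps)
  qed
  show ?thesis
  proof (rule that[OF R(1) s(1)])
    fix q a x
    assume q: "q \<in> frontier D" "dist q q0 < s" and a: "norm a = 1"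
      and pos: "\<And>y. y \<in> D \<Longrightarrow> 0 < a \<bullet> (y - q)"
      and x: "(norm (x - q))\<^sup>2 < 2 * R * (a \<bullet> (x - q))"
    have near: "ball q (e / 2) \<subseteq> U"
    proof -
      have "ball q (e / 2) \<subseteq> ball q0 e"
        using q(2) s by (subst ball_subset_ball_iff) auto
      then show ?thesis
        using e by auto
    qed
    have "q \<in> U"
      using near e by auto
    have "q \<notin> D"
      using q(1) \<open>open D\<close> by (simp add: frontier_def interior_open)
    have "isCont \<rho> q"
      using der[OF \<open>q \<in> U\<close>] by (rule has_derivative_continuous)
    have "\<rho> q = 0"
    proof (rule antisym)
      show "0 \<le> \<rho> q"
        using \<open>q \<notin> D\<close> in_D[OF \<open>q \<in> U\<close>] by simp
      show "\<rho> q \<le> 0"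
      proof (rule ccontr)
        assume "\<not> \<rho> q \<le> 0"
        then have "\<forall>\<^sub>F y in nhds q. 0 < \<rho> y"
          using \<open>isCont \<rho> q\<close> by (intro order_tendstoD(1)) (auto simp: isCont_def tendsto_at_iff_tendsto_nhds)
        moreover have "\<forall>\<^sub>F y in nhds q. y \<in> U"
          using \<open>q \<in> U\<close> \<open>open U\<close> by (rule eventually_nhds_in_open[rotated])
        ultimately have "\<forall>\<^sub>F y in nhds q. y \<notin> D"
          by eventually_elim (simp add: in_D)
        then obtain V where V: "open V" "q \<in> V" "V \<inter> D = {}"
          unfolding eventually_nhds by blast
        then have "V \<inter> closure D = {}"
          by (simp add: open_Int_closure_eq_empty)
        then show False
          using q(1) V(2) unfolding frontier_def by blast
      qed
    qed
    have below: "\<rho> y \<le> G q \<bullet> (y - q) + L * (norm (y - q))\<^sup>2" if "dist q y < e / 2" for y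
    proof -
      have "cball q (dist q y) \<subseteq> U"
        using that near by force
      then show ?thesis
        using lipschitz_gradient_estimate[OF der lip] \<open>\<rho> q = 0\<close> by fastforce
    qed
    have inside: "y \<in> D" if "dist q y < e / 2" "G q \<bullet> (y - q) + L * (norm (y - q))\<^sup>2 < 0" for y
    proof -
      have "y \<in> U" "\<rho> y < 0"
        using below[OF that(1)] that near by auto
      then show ?thesis
        by (simp add: in_D)
    qed
    have descent: "0 < a \<bullet> u" if u: "G q \<bullet> u < 0" for u
    proof -
      have "((\<lambda>\<epsilon>. G q \<bullet> u + \<epsilon> * (L * (norm u)\<^sup>2)) \<longlongrightarrow> G q \<bullet> u + 0 * (L * (norm u)\<^sup>2)) (at_right 0)"
        by (intro tendsto_intros)
      then have "\<forall>\<^sub>F \<epsilon> in at_right 0. G q \<bullet> u + \<epsilon> * (L * (norm u)\<^sup>2) < 0"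
        using u by (intro order_tendstoD(2)) auto
      moreover have "((\<lambda>\<epsilon>. \<epsilon> * norm u) \<longlongrightarrow> 0 * norm u) (at_right 0)"
        by (intro tendsto_intros)
      then have "\<forall>\<^sub>F \<epsilon> in at_right 0. \<epsilon> * norm u < e / 2"
        using e by (intro order_tendstoD(2)) auto
      ultimately have "\<forall>\<^sub>F \<epsilon> in at_right 0. 0 < \<epsilon> \<and>
          G q \<bullet> u + \<epsilon> * (L * (norm u)\<^sup>2) < 0 \<and> \<epsilon> * norm u < e / 2"
        using eventually_at_right_less[of 0] by eventually_elim simp
      then obtain \<epsilon> :: real where \<epsilon>: "0 < \<epsilon>" "G q \<bullet> u + \<epsilon> * (L * (norm u)\<^sup>2) < 0" "\<epsilon> * norm u < e / 2"
        using eventually_happens'[OF trivial_limit_at_right_real] by blast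
      have "\<epsilon> * (G q \<bullet> u + \<epsilon> * (L * (norm u)\<^sup>2)) < 0"
        using \<epsilon> by (simp add: mult_pos_neg)
      then have "q + \<epsilon> *\<^sub>R u \<in> D"
        using \<epsilon> by (intro inside) (auto simp: dist_norm power_mult_distrib power2_eq_square algebra_simps)
      then show ?thesis
        using pos[of "q + \<epsilon> *\<^sub>R u"] \<epsilon> by (simp add: zero_less_mult_iff)
    qed
    \<comment> \<open>If the part \<open>y\<close> of the gradient orthogonal to \<open>a\<close> did not vanish, then \<open>- y\<close> would lead from
      \<open>q\<close> into \<open>D\<close> within the supporting hyperplane.\<close>
    define k where "k = - (G q \<bullet> a)"
    define y where "y = G q + k *\<^sub>R a"
    have aa: "a \<bullet> a = 1"
      using a by (simp add: dot_square_norm)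
    have ya: "a \<bullet> y = 0"
      by (simp add: y_def k_def inner_add_right inner_diff_right aa inner_commute)
    have "y \<bullet> y = (G q + k *\<^sub>R a) \<bullet> y"
      by (simp only: y_def)
    then have "G q \<bullet> y = y \<bullet> y"
      using ya by (simp add: inner_add_left)
    then have "y = 0"
      using descent[of "- y"] ya inner_gt_zero_iff[of y] by auto
    then have Gq: "G q = - (k *\<^sub>R a)"
      by (simp add: y_def eq_neg_iff_add_eq_0)
    have "G q \<bullet> (- G q) < 0"
      using G0[OF \<open>q \<in> U\<close>] by simp
    then have "0 < a \<bullet> (- G q)"
      by (rule descent)
    then have "0 < k"
      by (simp add: k_def inner_commute)
    then have "norm (G q) = k"
      using a by (simp add: Gq)
    moreover have "norm (G q) \<ge> g / 2"
    proof -
      have "norm (G q0 - G q) \<le> L * dist q0 q"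
        using lipschitz_onD[OF lip U(2) \<open>q \<in> U\<close>] by (simp add: dist_norm)
      also have "\<dots> \<le> L * s"
        using q L by (intro mult_left_mono) (auto simp: dist_commute)
      finally show ?thesis
        using Ls norm_triangle_ineq2[of "G q0" "G q"] by (simp add: g_def)
    qed
    ultimately have k: "g / 2 \<le> k"
      by simp
    define h where "h = a \<bullet> (x - q)"
    have h: "0 < h"
      using le_less_trans[OF zero_le_power2 x] R(1) by (simp add: h_def zero_less_mult_iff)
    have "h \<le> norm (x - q)"
      unfolding h_def using norm_cauchy_schwarz[of a "x - q"] a by simp
    then have "2 * R * h \<le> 2 * R * norm (x - q)"
      using R(1) by simp
    then have "norm (x - q) * norm (x - q) < 2 * R * norm (x - q)"
      using x unfolding power2_eq_square h_def [symmetric] by linarith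
    then have "norm (x - q) < 2 * R"
      by (rule mult_right_less_imp_less) simp
    then have "dist q x < e / 2"
      using R(2) by (simp add: dist_norm norm_minus_commute)
    moreover have "L * (norm (x - q))\<^sup>2 \<le> L * (2 * R * h)"
      using x L by (intro mult_left_mono) (auto simp: h_def)
    moreover have "(2 * R * L) * h < k * h"
      using LR k h by (intro mult_strict_right_mono) auto
    moreover have "G q \<bullet> (x - q) = - (k * h)"
      by (simp add: Gq h_def)
    ultimately show "x \<in> D"
      by (intro inside) (auto simp: algebra_simps)
  qed
qed

section \<open>Long quadrilaterals\<close>

text \<open>\<^const>\<open>gromov_S\<close> is the sum of the two diagonals of the quadrilateral \<open>p x q w\<close> minus the
  larger sum of two opposite sides. It is therefore at least \<open>2 * r - 2 * C\<close>, which is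
  unbounded; the standard example is the square with vertices on the axes in the maximum norm.\<close>

lemma long_quadrilaterals_not_gromov_hyperbolic:
  fixes C :: real
  assumes d: "pseudodistance_on X d"
    and quad: "\<And>r. 0 < r \<Longrightarrow> \<exists>p\<in>X. \<exists>q\<in>X. \<exists>x\<in>X. \<exists>w\<in>X.
      d p x \<le> r \<and> d x q \<le> r \<and> d q w \<le> r \<and> d w p \<le> r \<and>
      2 * r - C \<le> d p q \<and> 2 * r - C \<le> d x w"
  shows "\<not> gromov_hyperbolic X d"
proof
  assume "gromov_hyperbolic X d"
  then obtain M where M: "\<And>p q x w. p \<in> X \<Longrightarrow> q \<in> X \<Longrightarrow> x \<in> X \<Longrightarrow> w \<in> X \<Longrightarrow>
      gromov_S d p q x w \<le> M"
    unfolding gromov_hyperbolic_def bdd_above_def by blast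
  define r where "r = max 1 (M / 2 + C + 1)"
  have "0 < r"
    by (simp add: r_def)
  then obtain p q x w where X: "p \<in> X" "q \<in> X" "x \<in> X" "w \<in> X"
    and sides: "d p x \<le> r" "d x q \<le> r" "d q w \<le> r" "d w p \<le> r"
    and diags: "2 * r - C \<le> d p q" "2 * r - C \<le> d x w"
    using quad by blast
  have "d p w = d w p" "d w q = d q w" "d w x = d x w"
    using d X by (auto simp: pseudodistance_on_def)
  then have "2 * r - 2 * C \<le> gromov_S d p q x w"
    using sides diags by (simp add: gromov_S_def gromov_product_def min_def)
  also have "\<dots> \<le> M"
    by (rule M) (rule X)+
  finally show False
    by (simp add: r_def max_def split: if_splits)
qed

section \<open>The quarter-plane along a flat boundary piece\<close>

text \<open>The flat piece \<open>F\<close> of the boundary in the complex line \<open>p + t *s v\<close> is a proper subset of this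
  line, as \<open>D\<close> contains no complex line. So it has a frontier point \<open>b\<close> that is touched from
  inside by discs in \<open>F\<close>. Near \<open>b\<close> the uniform interior balls at the points of \<open>F\<close> all have the
  axis \<open>a\<close>; their intersections with the complex lines in the direction \<open>a\<close> are discs of the same
  radius \<open>R\<close>, and together these sweep out a bidisc in \<open>D\<close> over a small touching disc. That \<open>b\<close>
  is a frontier point of the convex set \<open>F\<close> means that the ray from \<open>c\<close> leaves \<open>F\<close> at \<open>b\<close>.\<close>

lemma C11_boundary_flat_bidisc:
  fixes D :: "(complex ^ 'n) set"
  assumes "open D" "convex D" "D \<noteq> {}" and no_line: "\<not> (\<exists>L. complex_line L \<and> L \<subseteq> D)"
    and "C11_boundary D" and a: "norm a = 1" and v: "norm v = 1" "hermitian a v = 0"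
    and pos: "\<And>x. x \<in> D \<Longrightarrow> 0 < a \<bullet> (x - p)"
    and int: "interior ((\<lambda>t. p + t *s v) -` closure D) \<noteq> {}"
  obtains R b c where "0 < R" "b \<noteq> c"
    "p + b *s v \<in> closure D"
    "\<forall>y>1. p + (c + of_real y * (b - c)) *s v \<notin> closure D"
    "\<forall>\<zeta>\<in>ball (of_real R) R. \<forall>t\<in>ball c (dist b c). p + \<zeta> *s a + t *s v \<in> D"
proof -
  define F where "F = (\<lambda>t. p + t *s v) -` closure D"
  have "closed F"
    unfolding F_def by (intro closed_vimage closed_closure continuous_on_complex_line)
  have "convex F"
    unfolding F_def by (intro convex_complex_line_vimage convex_closure assms)
  have "F \<noteq> UNIV"
  proof
    assume "F = UNIV"
    then have cl: "p + t *s v \<in> closure D" for t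
      by (auto simp: F_def)
    obtain x where "x \<in> D"
      using assms by auto
    have "range (\<lambda>t. x + t *s v) \<subseteq> D"
      using complex_line_in_closure[OF assms(1,2) \<open>x \<in> D\<close> cl] by auto
    moreover have "v \<noteq> 0"
      using v by auto
    ultimately show False
      using no_line unfolding complex_line_def by blast
  qed
  obtain b where b: "b \<in> frontier F"
    and touch: "\<And>s. 0 < s \<Longrightarrow> \<exists>c. c \<noteq> b \<and> dist b c < s \<and> ball c (dist b c) \<subseteq> F"
    using frontier_touched_by_small_balls[OF \<open>closed F\<close> _ \<open>F \<noteq> UNIV\<close>] int
    unfolding F_def by blast
  have av: "a \<bullet> (t *s v) = 0" for t
    by (simp add: Re_hermitian [symmetric] hermitian_smult v)
  have fr: "p + t *s v \<in> frontier D" if "t \<in> F" for t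
  proof -
    have "p + t *s v \<notin> D"
      using pos[of "p + t *s v"] av[of t] by auto
    then show ?thesis
      using that \<open>open D\<close> by (simp add: F_def frontier_def interior_open)
  qed
  have "b \<in> F"
    using b \<open>closed F\<close> frontier_subset_closed by blast
  obtain R s where R: "0 < R" and s: "0 < s"
    and ball: "\<And>q a x. q \<in> frontier D \<Longrightarrow> dist q (p + b *s v) < s \<Longrightarrow> norm a = 1 \<Longrightarrow>
       (\<And>y. y \<in> D \<Longrightarrow> 0 < a \<bullet> (y - q)) \<Longrightarrow> (norm (x - q))\<^sup>2 < 2 * R * (a \<bullet> (x - q)) \<Longrightarrow> x \<in> D"
    using C11_boundary_interior_balls[OF \<open>open D\<close> \<open>C11_boundary D\<close> fr[OF \<open>b \<in> F\<close>]] by blast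
  obtain c where c: "c \<noteq> b" "dist b c < s / 2" "ball c (dist b c) \<subseteq> F"
    using touch[of "s / 2"] s by auto
  show ?thesis
  proof (rule that[of R b c]; (intro allI impI ballI)?)
    show "0 < R" "b \<noteq> c" "p + b *s v \<in> closure D"
      using R c(1) \<open>b \<in> F\<close> by (simp add: F_def)+
    show "p + (c + of_real y * (b - c)) *s v \<notin> closure D" if y: "1 < y" for y
    proof
      assume "p + (c + of_real y * (b - c)) *s v \<in> closure D"
      then have inF: "c + of_real y * (b - c) \<in> F"
        by (simp add: F_def)
      have "c \<in> interior F"
        using c(1,3) by (intro interiorI[of "ball c (dist b c)"]) simp+
      then have "c + of_real y * (b - c) - ((y - 1) / y) *\<^sub>R (c + of_real y * (b - c) - c) \<in> interior F"
        using y by (intro mem_interior_convex_shrink[OF \<open>convex F\<close> _ inF]) simp+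
      also have "c + of_real y * (b - c) - ((y - 1) / y) *\<^sub>R (c + of_real y * (b - c) - c) = b"
        using y by (simp add: scaleR_conv_of_real field_simps)
      finally show False
        using b by (simp add: frontier_def)
    qed
    show "p + \<zeta> *s a + t *s v \<in> D"
      if \<zeta>: "\<zeta> \<in> ball (of_real R) R" and t: "t \<in> ball c (dist b c)" for \<zeta> t
    \<comment> \<open>The disc of centre \<open>R\<close> and radius \<open>R\<close> is \<open>{\<zeta>. \<bar>\<zeta>\<bar>\<^sup>2 < 2 * R * Re \<zeta>}\<close>, which is the
      interior ball at \<open>p + t *s v\<close> cut by the complex line in the direction \<open>a\<close>.\<close>
    proof (rule ball[of "p + t *s v" a])
      have "t \<in> F"
        using t c(3) by blast
      then show "p + t *s v \<in> frontier D"
        by (rule fr)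
      have "p + t *s v - (p + b *s v) = (t - b) *s v"
        by (simp add: vector_sub_rdistrib)
      then have "dist (p + t *s v) (p + b *s v) = cmod (t - b)"
        unfolding dist_norm by (simp only: norm_smult_complex v mult_1_right)
      also have "\<dots> \<le> cmod (t - c) + cmod (b - c)"
        using norm_triangle_ineq4[of "t - c" "b - c"] by simp
      also have "\<dots> < s"
        using t c(2) by (simp add: dist_norm norm_minus_commute)
      finally show "dist (p + t *s v) (p + b *s v) < s" .
      show "0 < a \<bullet> (y - (p + t *s v))" if "y \<in> D" for y
        using pos[OF that] av[of t] by (simp add: inner_diff_right inner_add_right)
      have "(cmod (\<zeta> - of_real R))\<^sup>2 < R\<^sup>2"
        using \<zeta> by (intro power_strict_mono) (simp add: dist_norm norm_minus_commute)+
      then have "(cmod \<zeta>)\<^sup>2 < 2 * R * Re \<zeta>"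
        unfolding cmod_power2 by (simp add: power2_eq_square algebra_simps)
      moreover have "a \<bullet> (\<zeta> *s a) = Re \<zeta>"
        by (simp add: Re_hermitian [symmetric] hermitian_smult hermitian_self a)
      ultimately show "(norm (p + \<zeta> *s a + t *s v - (p + t *s v)))\<^sup>2
          < 2 * R * (a \<bullet> (p + \<zeta> *s a + t *s v - (p + t *s v)))"
        using a by (simp add: norm_smult_complex)
    qed (rule a)
  qed
qed

text \<open>The point \<open>b'\<close> on the ray from \<open>c\<close> that lies as far beyond \<open>b\<close> as \<open>c + tanh U * (b - c)\<close>
  lies before it is separated from \<open>D\<close> by a half-space. On the flat piece itself, the signed distance
  to the bounding hyperplane is an affine function along the ray, positive at \<open>b\<close> and negative at
  \<open>b'\<close>. Its values at \<open>c\<close> and at \<open>c + tanh U * (b - c)\<close> thus have a ratio of at least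
  \<open>1 / (2 * (1 - tanh U))\<close>. The half-space depends on \<open>U\<close>, but for fixed \<open>U\<close> the two points of
  \<open>D\<close> converge to these two points of the flat piece as \<open>\<tau>\<close> tends to infinity, and the
  estimate survives with \<open>6\<close> in place of \<open>2\<close>.\<close>

lemma kobayashi_tangential_lower_bound:
  fixes D :: "(complex ^ 'n) set" and U :: real
  assumes joined: "joined_by_discs D" and "convex D" "0 < U"
    and in_D: "\<And>\<tau> \<upsilon>. p + of_real (R * (1 - tanh \<tau>)) *s a + (c + of_real (tanh \<upsilon>) * (b - c)) *s v \<in> D"
    and b: "p + b *s v \<in> closure D"
    and beyond: "\<forall>y>1. p + (c + of_real y * (b - c)) *s v \<notin> closure D"
  shows "\<forall>\<^sub>F \<tau> in at_top. - ln (6 * (1 - tanh U)) / 2 \<le> kobayashi D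
    (p + of_real (R * (1 - tanh \<tau>)) *s a + (c + of_real (tanh 0) * (b - c)) *s v)
    (p + of_real (R * (1 - tanh \<tau>)) *s a + (c + of_real (tanh U) * (b - c)) *s v)"
proof -
  define x where "x = tanh U"
  have x: "0 < x" "x < 1"
    using \<open>0 < U\<close> by (simp add: x_def tanh_real_lt_1)+
  have "p + (c + of_real (2 - x) * (b - c)) *s v \<notin> closure D"
    using x by (intro beyond[rule_format]) simp
  then obtain n \<beta> where n: "n \<bullet> (p + (c + of_real (2 - x) * (b - c)) *s v) < \<beta>"
    "\<And>z. z \<in> closure D \<Longrightarrow> \<beta> < n \<bullet> z"
    using separating_hyperplane_closed_point[OF convex_closure[OF \<open>convex D\<close>] closed_closure]
    by blast
  \<comment> \<open>\<open>f0 + f1 * y\<close> is the value on the flat piece at parameter \<open>y\<close> of the ray, with \<open>y = 1\<close> at \<open>b\<close>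
    and \<open>y = 2 - x\<close> at \<open>b'\<close>; \<open>\<omega>\<close> is the slope in the normal direction.\<close>
  define f0 f1 \<omega> where "f0 = n \<bullet> (p + c *s v) - \<beta>" and "f1 = n \<bullet> ((b - c) *s v)" and "\<omega> = n \<bullet> a"
  have line: "n \<bullet> (p + of_real r *s a + (c + of_real y * (b - c)) *s v) - \<beta> = f0 + f1 * y + r * \<omega>"
    for r y :: real
  proof -
    have "(c + of_real y * (b - c)) *s v = c *s v + y *\<^sub>R ((b - c) *s v)"
      by (simp add: vec_eq_iff) (simp add: scaleR_conv_of_real algebra_simps)
    then show ?thesis
      by (simp add: f0_def f1_def \<omega>_def of_real_smult inner_add_right)
  qed
  have "f0 + f1 * (2 - x) < 0"
    using n(1) line[of 0 "2 - x"] by simp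
  moreover have "0 < f0 + f1 * 1"
    using n(2)[OF b] line[of 0 1] by simp
  ultimately have "f1 * (1 - x) < 0"
    by (simp add: algebra_simps)
  then have "f1 < 0"
    using x mult_nonneg_nonneg[of f1 "1 - x"] by linarith
  define g where "g = - f1"
  have g: "0 < g" "g < f0" "f0 - g * x < 2 * (g * (1 - x))"
    using \<open>f1 < 0\<close> \<open>0 < f0 + f1 * 1\<close> \<open>f0 + f1 * (2 - x) < 0\<close>
    by (simp add: g_def algebra_simps)+
  have "((\<lambda>\<tau>. R * (1 - tanh \<tau>) * \<omega>) \<longlongrightarrow> R * (1 - 1) * \<omega>) at_top"
    by (intro tendsto_intros tanh_real_at_top)
  then have "((\<lambda>\<tau>. \<bar>R * (1 - tanh \<tau>) * \<omega>\<bar>) \<longlongrightarrow> 0) at_top"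
    by (intro tendsto_rabs_zero) simp
  then have "\<forall>\<^sub>F \<tau> in at_top. \<bar>R * (1 - tanh \<tau>) * \<omega>\<bar> < g * (1 - x) / 2"
    using g(1) x by (intro order_tendstoD(2)) simp+
  then show ?thesis
  proof eventually_elim
    fix \<tau> assume small: "\<bar>R * (1 - tanh \<tau>) * \<omega>\<bar> < g * (1 - x) / 2"
    have gx: "g * (1 - x) \<le> g" "0 < g * (1 - x)"
      using g(1) x by (simp add: mult_le_cancel_left1)+
    define m where "m = (\<lambda>y. n \<bullet> (p + of_real (R * (1 - tanh \<tau>)) *s a +
      (c + of_real (tanh y) * (b - c)) *s v) - \<beta>)"
    have m: "m y = f0 - g * tanh y + R * (1 - tanh \<tau>) * \<omega>" for y
      unfolding m_def line by (simp add: g_def)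
    have m0: "g / 2 \<le> m 0" and mU: "m U \<le> 3 * g * (1 - x)"
      using small g gx by (simp add: m x_def [symmetric] abs_less_iff)+
    have mpos: "0 < m y" for y
      unfolding m_def using n(2)[OF subsetD[OF closure_subset in_D]] by simp
    have "m U \<le> 3 * g * (1 - x)"
      by (rule mU)
    also have "\<dots> = 6 * (1 - x) * (g / 2)"
      by (simp add: algebra_simps)
    also have "\<dots> \<le> 6 * (1 - x) * m 0"
      using m0 x by (intro mult_left_mono) simp+
    finally have "ln (m U) \<le> ln (6 * (1 - x) * m 0)"
      using mpos by (intro ln_mono) simp+
    also have "\<dots> = ln (6 * (1 - x)) + ln (m 0)"
      using x mpos[of 0] by (intro ln_mult_pos) simp+
    finally have "- ln (6 * (1 - x)) / 2 \<le> (ln (m 0) - ln (m U)) / 2"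
      by simp
    also have "\<dots> \<le> kobayashi D
        (p + of_real (R * (1 - tanh \<tau>)) *s a + (c + of_real (tanh 0) * (b - c)) *s v)
        (p + of_real (R * (1 - tanh \<tau>)) *s a + (c + of_real (tanh U) * (b - c)) *s v)"
      unfolding m_def using n(2) closure_subset[of D]
      by (intro kobayashi_ge_half_space joined in_D) blast
    finally show "- ln (6 * (1 - tanh U)) / 2 \<le> kobayashi D
        (p + of_real (R * (1 - tanh \<tau>)) *s a + (c + of_real (tanh 0) * (b - c)) *s v)
        (p + of_real (R * (1 - tanh \<tau>)) *s a + (c + of_real (tanh U) * (b - c)) *s v)"
      unfolding x_def .
  qed
qed

theorem theorem1:
  fixes D :: "(complex ^ 2) set"
  assumes "open D" and "connected D" and "D \<noteq> {}"
    and "convex D"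
    and "\<not> (\<exists>L. complex_line L \<and> L \<subseteq> D)"
    and "C11_boundary D"
    and "contains_analytic_disc (frontier D)"
  shows "\<not> gromov_hyperbolic D (kobayashi D)"
proof -
  have joined: "joined_by_discs D"
    by (rule convex_line_free_joined_by_discs) fact+
  obtain a v p where a: "norm a = 1" and v: "norm v = 1" "hermitian a v = 0"
    and pos: "\<And>x. x \<in> D \<Longrightarrow> 0 < a \<bullet> (x - p)"
    and int: "interior ((\<lambda>t. p + t *s v) -` closure D) \<noteq> {}"
    using analytic_disc_frontier_affine[OF assms(1,4,3,7)] by blast
  obtain R b c where R: "0 < R" and "b \<noteq> c" and b: "p + b *s v \<in> closure D"
    and beyond: "\<forall>y>1. p + (c + of_real y * (b - c)) *s v \<notin> closure D"
    and bidisc: "\<forall>\<zeta>\<in>ball (of_real R) R. \<forall>t\<in>ball c (dist b c). p + \<zeta> *s a + t *s v \<in> D"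
    by (rule C11_boundary_flat_bidisc[OF assms(1,4,3,5,6) a v pos int])
  \<comment> \<open>Logarithmic coordinates: \<open>\<tau>\<close> measures the approach to the boundary along the normal,
    \<open>\<upsilon>\<close> the approach to \<open>b\<close> along the flat piece.\<close>
  define P where "P = (\<lambda>\<tau> \<upsilon>. p + of_real (R * (1 - tanh \<tau>)) *s a +
    (c + of_real (tanh \<upsilon>) * (b - c)) *s v)"
  have unit_bidisc: "(p + of_real R *s a + c *s v) + \<xi> *s (- (of_real R *s a)) + \<eta> *s ((b - c) *s v) \<in> D"
    if "cmod \<xi> < 1" "cmod \<eta> < 1" for \<xi> \<eta>
  proof -
    have "p + (of_real R * (1 - \<xi>)) *s a + (c + \<eta> * (b - c)) *s v \<in> D"
    proof (rule bidisc[rule_format])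
      have "of_real R - of_real R * (1 - \<xi>) = of_real R * \<xi>"
        by (simp add: algebra_simps)
      then show "of_real R * (1 - \<xi>) \<in> ball (of_real R) R"
        using that R by (simp add: dist_norm norm_mult)
      show "c + \<eta> * (b - c) \<in> ball c (dist b c)"
        using that \<open>b \<noteq> c\<close> by (simp add: dist_norm norm_mult)
    qed
    also have "p + (of_real R * (1 - \<xi>)) *s a + (c + \<eta> * (b - c)) *s v =
        (p + of_real R *s a + c *s v) + \<xi> *s (- (of_real R *s a)) + \<eta> *s ((b - c) *s v)"
      by (simp add: vec_eq_iff algebra_simps)
    finally show ?thesis .
  qed
  have P_eq: "P \<tau> \<upsilon> = (p + of_real R *s a + c *s v) + of_real (tanh \<tau>) *s (- (of_real R *s a)) +
      of_real (tanh \<upsilon>) *s ((b - c) *s v)" for \<tau> \<upsilon>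
    by (simp add: P_def vec_eq_iff algebra_simps)
  have P_in: "P \<tau> \<upsilon> \<in> D" for \<tau> \<upsilon>
    unfolding P_eq by (intro unit_bidisc) (simp add: abs_tanh_less_one)+
  have upper: "kobayashi D (P \<tau> \<upsilon>) (P \<tau>' \<upsilon>') \<le> r"
    if "0 < r" "\<bar>\<tau>' - \<tau>\<bar> \<le> r" "\<bar>\<upsilon>' - \<upsilon>\<bar> \<le> r" for \<tau> \<upsilon> \<tau>' \<upsilon>' r
    unfolding P_eq by (rule kobayashi_le_bidisc[OF joined unit_bidisc that])
  \<comment> \<open>The larger of the errors of the two lower bounds; the normal direction alone needs only
    \<open>ln 2 / 2\<close>.\<close>
  define C :: real where "C = ln 12 / 2"
  have normal: "\<tau>' - \<tau> - C \<le> kobayashi D (P \<tau> \<upsilon>) (P \<tau>' \<upsilon>)"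
    if "0 \<le> \<tau>" "\<tau> \<le> \<tau>'" for \<tau> \<tau>' \<upsilon>
  proof -
    have depth: "a \<bullet> P \<tau> \<upsilon> - a \<bullet> p = R * (1 - tanh \<tau>)" for \<tau>
    proof -
      have "a \<bullet> (t *s v) = 0" for t
        by (simp add: Re_hermitian [symmetric] hermitian_smult v)
      moreover have "a \<bullet> (w *s a) = Re w" for w
        by (simp add: Re_hermitian [symmetric] hermitian_smult hermitian_self a)
      ultimately show ?thesis
        by (simp add: P_def inner_add_right)
    qed
    have ln_depth: "ln (R * (1 - tanh \<tau>)) = ln R + ln (1 - tanh \<tau>)" for \<tau>
      using R tanh_real_lt_1[of \<tau>] by (simp add: ln_mult)
    have "ln 2 / 2 \<le> C"
      by (simp add: C_def)
    then have "\<tau>' - \<tau> - C \<le> (ln (R * (1 - tanh \<tau>)) - ln (R * (1 - tanh \<tau>'))) / 2"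
      using ln_one_minus_tanh_ge[OF that(1)] ln_one_minus_tanh_le[of \<tau>']
      unfolding ln_depth by (simp add: field_simps)
    also have "\<dots> \<le> kobayashi D (P \<tau> \<upsilon>) (P \<tau>' \<upsilon>)"
      unfolding depth [symmetric] using pos
      by (intro kobayashi_ge_half_space joined P_in) (simp add: inner_diff_right)
    finally show ?thesis .
  qed
  have tangential: "\<forall>\<^sub>F \<tau> in at_top. U - C \<le> kobayashi D (P \<tau> 0) (P \<tau> U)" if "0 < U" for U
  proof -
    have "\<forall>\<^sub>F \<tau> in at_top. - ln (6 * (1 - tanh U)) / 2 \<le> kobayashi D (P \<tau> 0) (P \<tau> U)"
      unfolding P_def
      by (rule kobayashi_tangential_lower_bound[OF joined \<open>convex D\<close> that P_in[unfolded P_def] b beyond])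
    moreover have "U - C \<le> - ln (6 * (1 - tanh U)) / 2"
    proof -
      have "ln (6 * (1 - tanh U)) = ln 6 + ln (1 - tanh U)"
        by (rule ln_mult_pos) (simp add: tanh_real_lt_1)+
      moreover have "ln 12 = ln 6 + ln (2 :: real)"
        using ln_mult_pos[of "6 :: real" 2] by simp
      ultimately show ?thesis
        using ln_one_minus_tanh_le[of U] by (simp add: C_def field_simps)
    qed
    ultimately show ?thesis
      by (auto elim: eventually_mono)
  qed
  show ?thesis
  proof (rule long_quadrilaterals_not_gromov_hyperbolic[where C = C])
    show "pseudodistance_on D (kobayashi D)"
      using joined_by_discsD[OF joined] by (intro kobayashi_greatest(1))
    fix r :: real assume r: "0 < r"
    \<comment> \<open>The square with vertices \<open>(T - r, r)\<close>, \<open>(T, 0)\<close>, \<open>(T + r, r)\<close>, \<open>(T, 2 * r)\<close>, moved far enough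
      out in the first coordinate for the tangential bound to apply.\<close>
    have "\<forall>\<^sub>F \<tau> in at_top. r \<le> \<tau>"
      by (rule eventually_ge_at_top)
    then have "\<forall>\<^sub>F \<tau> in at_top. r \<le> \<tau> \<and> 2 * r - C \<le> kobayashi D (P \<tau> 0) (P \<tau> (2 * r))"
      by (rule eventually_conj) (rule tangential, use r in simp)
    then obtain T where T: "r \<le> T" "2 * r - C \<le> kobayashi D (P T 0) (P T (2 * r))"
      using eventually_happens'[OF trivial_limit_at_top_linorder] by blast
    have diagonal: "2 * r - C \<le> kobayashi D (P (T - r) r) (P (T + r) r)"
      using normal[of "T - r" "T + r" r] T(1) r by simp
    have sides: "kobayashi D (P (T - r) r) (P T 0) \<le> r" "kobayashi D (P T 0) (P (T + r) r) \<le> r"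
      "kobayashi D (P (T + r) r) (P T (2 * r)) \<le> r" "kobayashi D (P T (2 * r)) (P (T - r) r) \<le> r"
      by (rule upper[OF r]; use r in simp)+
    show "\<exists>p\<in>D. \<exists>q\<in>D. \<exists>x\<in>D. \<exists>w\<in>D. kobayashi D p x \<le> r \<and> kobayashi D x q \<le> r \<and>
        kobayashi D q w \<le> r \<and> kobayashi D w p \<le> r \<and>
        2 * r - C \<le> kobayashi D p q \<and> 2 * r - C \<le> kobayashi D x w"
      by (rule bexI[of _ "P (T - r) r"], rule bexI[of _ "P (T + r) r"], rule bexI[of _ "P T 0"],
          rule bexI[of _ "P T (2 * r)"]) (intro conjI sides diagonal T(2) P_in)+
  qed
qed

end
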